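(* Let $\mathcal L\in\{\mathbf{nbIciw},\mathbf{nbIci},\mathbf{nbIcl}\}$. For every set of formulas $\Gamma\cup\{\varphi\}\subseteq\mathbf F(\Sigma_{\mathbf{nbI}},\mathcal V)$: $\Gamma\vDash_{\mathcal L}\varphi$ if and only if $\Gamma\vDash_{\mathcal M^{\mathbf 2}_{\mathcal L}}\varphi$. Hence, $\Gamma\vdash_{\mathcal L}\varphi$ if and only if $\Gamma\vDash_{\mathcal M^{\mathbf 2}_{\mathcal L}}\varphi$.
   Context: Let $\mathcal V$ be a countable set of propositional variables and $\Sigma_{\mathbf{nbI}}=\{\vee,\wedge,\rightarrow,\uparrow,\neg\}$ with $\neg$ unary and the other connectives binary; $\mathbf F(\Sigma_{\mathbf{nbI}},\mathcal V)$ is the set of formulas. The logic $\mathbf{nbI}$ is the Hilbert calculus whose only inference rule is Modus Ponens and whose axioms are all instances (with arbitrary formulas) of: (1) $\alpha\to(\beta\to\alpha)$; (2) $(\alpha\to(\beta\to\gamma))\to((\alpha\to\beta)\to(\alpha\to\gamma))$; (3) $\alpha\to(\beta\to(\alpha\wedge\beta))$; (4) $(\alpha\wedge\beta)\to\alpha$; (5) $(\alpha\wedge\beta)\to\beta$; (6) $\alpha\to(\alpha\vee\beta)$; (7) $\beta\to(\alpha\vee\beta)$; (8) $(\alpha\to\gamma)\to((\beta\to\gamma)\to((\alpha\vee\beta)\to\gamma))$; (9) $(\alpha\to\beta)\vee\alpha$; (Ip) $(\alpha\uparrow\beta)\to(\alpha\to(\beta\to\gamma))$; (Comm) $(\alpha\uparrow\beta)\to(\beta\uparrow\alpha)$;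 (11) $\alpha\vee\neg\alpha$. The logics $\mathbf{nbIciw}$, $\mathbf{nbIci}$, $\mathbf{nbIcl}$ are obtained from $\mathbf{nbI}$ by adding, respectively, all instances of $(\alpha\uparrow\neg\alpha)\vee(\alpha\wedge\neg\alpha)$; of $\neg(\alpha\uparrow\neg\alpha)\to(\alpha\wedge\neg\alpha)$; of $\neg(\alpha\wedge\neg\alpha)\to(\alpha\uparrow\neg\alpha)$. $\Gamma\vdash_{\mathcal L}\varphi$ means that there is a finite derivation of $\varphi$ from premises in $\Gamma$ in the calculus of $\mathcal L$. A bivaluation for $\mathbf{nbI}$ is a map $\nu:\mathbf F(\Sigma_{\mathbf{nbI}},\mathcal V)\to\{0,1\}$ such that for all formulas $\alpha,\beta$: $\nu(\alpha\vee\beta)=1$ iff $\nu(\alpha)=1$ or $\nu(\beta)=1$; $\nu(\alpha\wedge\beta)=1$ iff $\nu(\alpha)=\nu(\beta)=1$; $\nu(\alpha\to\beta)=1$ iff $\nu(\alpha)=0$ or $\nu(\beta)=1$; if $\nu(\alpha\uparrow\beta)=1$ then $\nu(\alpha)=0$ or $\nu(\beta)=0$; $\nu(\alpha\uparrow\beta)=\nu(\beta\uparrow\alpha)$; if $\nu(\neg\alpha)=0$ then $\nu(\alpha)=1$. A bivaluation for $\mathcal L$ is a bivaluation $\nu$ for $\mathbf{nbI}$ such that for all $\alpha$: if $\nu(\alpha\uparrow\neg\alpha)=0$ then $\nu(\alpha)=\nu(\neg\alpha)=1$; if $\mathcal L=\mathbf{nbIci}$, moreover, $\nu(\neg(\alpha\uparrow\neg\alpha))=1$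 implies $\nu(\alpha)=\nu(\neg\alpha)=1$; if $\mathcal L=\mathbf{nbIcl}$, moreover, $\nu(\neg(\alpha\wedge\neg\alpha))=1$ implies $\nu(\alpha\uparrow\neg\alpha)=1$. $\Gamma\vDash_{\mathcal L}\varphi$ means: for every bivaluation $\nu$ for $\mathcal L$, if $\nu(\gamma)=1$ for all $\gamma\in\Gamma$ then $\nu(\varphi)=1$. Let $\mathbf 2_{\mathbf{nbI}}$ be the multialgebra with universe $\{0,1\}$ in which $\vee,\wedge,\to$ (and the complement ${\sim}$) are the usual Boolean operations, $1\uparrow1=\{0\}$, $x\uparrow y=\{0,1\}$ otherwise, and $\neg0=\{1\}$, $\neg1=\{0,1\}$. A valuation over $\mathbf 2_{\mathbf{nbI}}$ is a map $\nu:\mathbf F(\Sigma_{\mathbf{nbI}},\mathcal V)\to\{0,1\}$ with $\nu(\alpha\#\beta)=\nu(\alpha)\#\nu(\beta)$ for $\#\in\{\vee,\wedge,\to\}$, $\nu(\alpha\uparrow\beta)\in\nu(\alpha)\uparrow\nu(\beta)$ and $\nu(\neg\alpha)\in\neg\nu(\alpha)$. The restricted non-deterministic matrix $\mathcal M^{\mathbf 2}_{\mathcal L}=(\mathbf 2_{\mathbf{nbI}},\{1\},\mathcal F_{\mathbf 2_{\mathcal L}})$ has $\mathcal F_{\mathbf 2_{\mathcal L}}$ equal to the set of all valuations $\nu$ over $\mathbf 2_{\mathbf{nbI}}$ such that for all formulas $\alpha,\beta$: $\nu(\alpha\uparrow\beta)=\nu(\beta\uparrow\alpha)$; $\nu(\alpha\uparrow\neg\alpha)={\sim}(\nu(\alpha)\wedge\nu(\neg\alpha))$;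 if $\mathcal L=\mathbf{nbIci}$: $\nu(\neg(\alpha\uparrow\neg\alpha))=\nu(\alpha)\wedge\nu(\neg\alpha)$; if $\mathcal L=\mathbf{nbIcl}$: $\nu(\alpha\uparrow\neg\alpha)=\nu(\neg(\alpha\wedge\neg\alpha))$. $\Gamma\vDash_{\mathcal M^{\mathbf 2}_{\mathcal L}}\varphi$ means: for every $\nu\in\mathcal F_{\mathbf 2_{\mathcal L}}$, if $\nu(\gamma)=1$ for all $\gamma\in\Gamma$ then $\nu(\varphi)=1$. *)

theory Defs
  imports "HOL-Library.Countable"
begin

section \<open>Formulas\<close>

datatype 'v fm =
    Var 'v
  | Disj "'v fm" "'v fm"  (infixr \<open>\<^bold>\<or>\<close> 130)
  | Conj "'v fm" "'v fm"  (infixr \<open>\<^bold>\<and>\<close> 135)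
  | Imp "'v fm" "'v fm"  (infixr \<open>\<^bold>\<longrightarrow>\<close> 120)
  | Inc "'v fm" "'v fm"  (infix \<open>\<^bold>\<up>\<close> 140)
  | Neg "'v fm"  (\<open>\<^bold>\<not> _\<close> [150] 150)

datatype nbI_ext = nbIciw | nbIci | nbIcl


section \<open>Hilbert calculi\<close>

inductive_set nbI_axioms :: "'v fm set" where
  Ax1: "\<alpha> \<^bold>\<longrightarrow> (\<beta> \<^bold>\<longrightarrow> \<alpha>) \<in> nbI_axioms"
| Ax2: "(\<alpha> \<^bold>\<longrightarrow> (\<beta> \<^bold>\<longrightarrow> \<gamma>)) \<^bold>\<longrightarrow> ((\<alpha> \<^bold>\<longrightarrow> \<beta>) \<^bold>\<longrightarrow> (\<alpha> \<^bold>\<longrightarrow> \<gamma>)) \<in> nbI_axioms"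
| Ax3: "\<alpha> \<^bold>\<longrightarrow> (\<beta> \<^bold>\<longrightarrow> (\<alpha> \<^bold>\<and> \<beta>)) \<in> nbI_axioms"
| Ax4: "(\<alpha> \<^bold>\<and> \<beta>) \<^bold>\<longrightarrow> \<alpha> \<in> nbI_axioms"
| Ax5: "(\<alpha> \<^bold>\<and> \<beta>) \<^bold>\<longrightarrow> \<beta> \<in> nbI_axioms"
| Ax6: "\<alpha> \<^bold>\<longrightarrow> (\<alpha> \<^bold>\<or> \<beta>) \<in> nbI_axioms"
| Ax7: "\<beta> \<^bold>\<longrightarrow> (\<alpha> \<^bold>\<or> \<beta>) \<in> nbI_axioms"
| Ax8: "(\<alpha> \<^bold>\<longrightarrow> \<gamma>) \<^bold>\<longrightarrow> ((\<beta> \<^bold>\<longrightarrow> \<gamma>) \<^bold>\<longrightarrow> ((\<alpha> \<^bold>\<or> \<beta>) \<^bold>\<longrightarrow> \<gamma>)) \<in> nbI_axioms"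
| Ax9: "(\<alpha> \<^bold>\<longrightarrow> \<beta>) \<^bold>\<or> \<alpha> \<in> nbI_axioms"
| Ip: "(\<alpha> \<^bold>\<up> \<beta>) \<^bold>\<longrightarrow> (\<alpha> \<^bold>\<longrightarrow> (\<beta> \<^bold>\<longrightarrow> \<gamma>)) \<in> nbI_axioms"
| Comm: "(\<alpha> \<^bold>\<up> \<beta>) \<^bold>\<longrightarrow> (\<beta> \<^bold>\<up> \<alpha>) \<in> nbI_axioms"
| Ax11: "\<alpha> \<^bold>\<or> \<^bold>\<not> \<alpha> \<in> nbI_axioms"

fun ext_axioms :: "nbI_ext \<Rightarrow> 'v fm set" where
  "ext_axioms nbIciw = {(\<alpha> \<^bold>\<up> \<^bold>\<not> \<alpha>) \<^bold>\<or> (\<alpha> \<^bold>\<and> \<^bold>\<not> \<alpha>) |\<alpha>. True}"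
| "ext_axioms nbIci = {\<^bold>\<not> (\<alpha> \<^bold>\<up> \<^bold>\<not> \<alpha>) \<^bold>\<longrightarrow> (\<alpha> \<^bold>\<and> \<^bold>\<not> \<alpha>) |\<alpha>. True}"
| "ext_axioms nbIcl = {\<^bold>\<not> (\<alpha> \<^bold>\<and> \<^bold>\<not> \<alpha>) \<^bold>\<longrightarrow> (\<alpha> \<^bold>\<up> \<^bold>\<not> \<alpha>) |\<alpha>. True}"

definition derivation :: "nbI_ext \<Rightarrow> 'v fm set \<Rightarrow> 'v fm list \<Rightarrow> bool" where
  "derivation L \<Gamma> ds \<longleftrightarrow>
     (\<forall>i < length ds.
        ds ! i \<in> nbI_axioms \<union> ext_axioms L \<or>
        ds ! i \<in> \<Gamma> \<or>
        (\<exists>j < i. \<exists>k < i. ds ! k = (ds ! j) \<^bold>\<longrightarrow> (ds ! i)))"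

definition derivable :: "nbI_ext \<Rightarrow> 'v fm set \<Rightarrow> 'v fm \<Rightarrow> bool" where
  "derivable L \<Gamma> \<phi> \<longleftrightarrow> (\<exists>ds. derivation L \<Gamma> ds \<and> ds \<noteq> [] \<and> last ds = \<phi>)"


section \<open>Bivaluations\<close>

text \<open>The truth values 1 and 0 are rendered as \<^term>\<open>True\<close> and \<^term>\<open>False\<close>.\<close>

definition nbI_bivaluation :: "('v fm \<Rightarrow> bool) \<Rightarrow> bool" where
  "nbI_bivaluation \<nu> \<longleftrightarrow>
     (\<forall>\<alpha> \<beta>. \<nu> (\<alpha> \<^bold>\<or> \<beta>) \<longleftrightarrow> \<nu> \<alpha> \<or> \<nu> \<beta>) \<and>
     (\<forall>\<alpha> \<beta>. \<nu> (\<alpha> \<^bold>\<and> \<beta>) \<longleftrightarrow> \<nu> \<alpha> \<and> \<nu> \<beta>) \<and>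
     (\<forall>\<alpha> \<beta>. \<nu> (\<alpha> \<^bold>\<longrightarrow> \<beta>) \<longleftrightarrow> \<not> \<nu> \<alpha> \<or> \<nu> \<beta>) \<and>
     (\<forall>\<alpha> \<beta>. \<nu> (\<alpha> \<^bold>\<up> \<beta>) \<longrightarrow> \<not> \<nu> \<alpha> \<or> \<not> \<nu> \<beta>) \<and>
     (\<forall>\<alpha> \<beta>. \<nu> (\<alpha> \<^bold>\<up> \<beta>) = \<nu> (\<beta> \<^bold>\<up> \<alpha>)) \<and>
     (\<forall>\<alpha>. \<not> \<nu> (\<^bold>\<not> \<alpha>) \<longrightarrow> \<nu> \<alpha>)"

definition bivaluation :: "nbI_ext \<Rightarrow> ('v fm \<Rightarrow> bool) \<Rightarrow> bool" where
  "bivaluation L \<nu> \<longleftrightarrow>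
     nbI_bivaluation \<nu> \<and>
     (\<forall>\<alpha>. \<not> \<nu> (\<alpha> \<^bold>\<up> \<^bold>\<not> \<alpha>) \<longrightarrow> \<nu> \<alpha> \<and> \<nu> (\<^bold>\<not> \<alpha>)) \<and>
     (L = nbIci \<longrightarrow> (\<forall>\<alpha>. \<nu> (\<^bold>\<not> (\<alpha> \<^bold>\<up> \<^bold>\<not> \<alpha>)) \<longrightarrow> \<nu> \<alpha> \<and> \<nu> (\<^bold>\<not> \<alpha>))) \<and>
     (L = nbIcl \<longrightarrow> (\<forall>\<alpha>. \<nu> (\<^bold>\<not> (\<alpha> \<^bold>\<and> \<^bold>\<not> \<alpha>)) \<longrightarrow> \<nu> (\<alpha> \<^bold>\<up> \<^bold>\<not> \<alpha>)))"

definition bival_conseq :: "nbI_ext \<Rightarrow> 'v fm set \<Rightarrow> 'v fm \<Rightarrow> bool" where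
  "bival_conseq L \<Gamma> \<phi> \<longleftrightarrow> (\<forall>\<nu>. bivaluation L \<nu> \<longrightarrow> (\<forall>\<gamma> \<in> \<Gamma>. \<nu> \<gamma>) \<longrightarrow> \<nu> \<phi>)"


section \<open>Restricted non-deterministic matrices\<close>

text \<open>The universe of a multialgebra is the type \<open>'a\<close>; each operation returns the set
  of its possible values.\<close>

record 'a multialgebra =
  disj :: "'a \<Rightarrow> 'a \<Rightarrow> 'a set"
  conj :: "'a \<Rightarrow> 'a \<Rightarrow> 'a set"
  imp :: "'a \<Rightarrow> 'a \<Rightarrow> 'a set"
  inc :: "'a \<Rightarrow> 'a \<Rightarrow> 'a set"
  neg :: "'a \<Rightarrow> 'a set"

definition valuation :: "'a multialgebra \<Rightarrow> ('v fm \<Rightarrow> 'a) \<Rightarrow> bool" where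
  "valuation A \<nu> \<longleftrightarrow>
     (\<forall>\<alpha> \<beta>. \<nu> (\<alpha> \<^bold>\<or> \<beta>) \<in> disj A (\<nu> \<alpha>) (\<nu> \<beta>)) \<and>
     (\<forall>\<alpha> \<beta>. \<nu> (\<alpha> \<^bold>\<and> \<beta>) \<in> conj A (\<nu> \<alpha>) (\<nu> \<beta>)) \<and>
     (\<forall>\<alpha> \<beta>. \<nu> (\<alpha> \<^bold>\<longrightarrow> \<beta>) \<in> imp A (\<nu> \<alpha>) (\<nu> \<beta>)) \<and>
     (\<forall>\<alpha> \<beta>. \<nu> (\<alpha> \<^bold>\<up> \<beta>) \<in> inc A (\<nu> \<alpha>) (\<nu> \<beta>)) \<and>
     (\<forall>\<alpha>. \<nu> (\<^bold>\<not> \<alpha>) \<in> neg A (\<nu> \<alpha>))"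

record ('v, 'a) rnmatrix =
  algebra :: "'a multialgebra"
  designated :: "'a set"
  restricted :: "('v fm \<Rightarrow> 'a) set"

definition rnmatrix_conseq :: "('v, 'a) rnmatrix \<Rightarrow> 'v fm set \<Rightarrow> 'v fm \<Rightarrow> bool" where
  "rnmatrix_conseq M \<Gamma> \<phi> \<longleftrightarrow>
     (\<forall>\<nu> \<in> restricted M. (\<forall>\<gamma> \<in> \<Gamma>. \<nu> \<gamma> \<in> designated M) \<longrightarrow> \<nu> \<phi> \<in> designated M)"

definition two_nbI :: "bool multialgebra" where
  "two_nbI =
     \<lparr> disj = \<lambda>x y. {x \<or> y},
       conj = \<lambda>x y. {x \<and> y},
       imp = \<lambda>x y. {x \<longrightarrow> y},
       inc = \<lambda>x y. if x \<and> y then {False} else {False, True},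
       neg = \<lambda>x. if x then {False, True} else {True} \<rparr>"

definition two_restricted :: "nbI_ext \<Rightarrow> ('v fm \<Rightarrow> bool) set" where
  "two_restricted L =
     {\<nu>. valuation two_nbI \<nu> \<and>
         (\<forall>\<alpha> \<beta>. \<nu> (\<alpha> \<^bold>\<up> \<beta>) = \<nu> (\<beta> \<^bold>\<up> \<alpha>)) \<and>
         (\<forall>\<alpha>. \<nu> (\<alpha> \<^bold>\<up> \<^bold>\<not> \<alpha>) = (\<not> (\<nu> \<alpha> \<and> \<nu> (\<^bold>\<not> \<alpha>)))) \<and>
         (L = nbIci \<longrightarrow> (\<forall>\<alpha>. \<nu> (\<^bold>\<not> (\<alpha> \<^bold>\<up> \<^bold>\<not> \<alpha>)) = (\<nu> \<alpha> \<and> \<nu> (\<^bold>\<not> \<alpha>)))) \<and>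
         (L = nbIcl \<longrightarrow> (\<forall>\<alpha>. \<nu> (\<alpha> \<^bold>\<up> \<^bold>\<not> \<alpha>) = \<nu> (\<^bold>\<not> (\<alpha> \<^bold>\<and> \<^bold>\<not> \<alpha>))))}"

definition two_rnmatrix :: "nbI_ext \<Rightarrow> ('v, bool) rnmatrix" where
  "two_rnmatrix L =
     \<lparr> algebra = two_nbI, designated = {True}, restricted = two_restricted L \<rparr>"

end

theory Submission
  imports Defs
begin

text \<open>
  A bivaluation already is a restricted valuation over the two-element multialgebra. The
  clauses of a bivaluation that are one-way implications become the equations of the restricted
  matrix because the converse implications come for free: if \<open>\<alpha>\<close> and \<open>\<^bold>\<not> \<alpha>\<close> both hold, then
  \<open>\<alpha> \<^bold>\<up> \<^bold>\<not> \<alpha>\<close> fails by the clause for \<open>\<^bold>\<up>\<close>, hence \<open>\<^bold>\<not> (\<alpha> \<^bold>\<up> \<^bold>\<not> \<alpha>)\<close> holds by excluded middle; and if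
  \<open>\<alpha> \<^bold>\<up> \<^bold>\<not> \<alpha>\<close> holds, then \<open>\<alpha> \<^bold>\<and> \<^bold>\<not> \<alpha>\<close> fails, hence \<open>\<^bold>\<not> (\<alpha> \<^bold>\<and> \<^bold>\<not> \<alpha>)\<close> holds. So the two semantic
  consequence relations agree because they quantify over the same maps
  (\<open>two_restricted_eq_bivaluations\<close>).

  It remains to relate derivability to bivaluations. Soundness is an induction on derivations.
  For completeness, let \<open>\<phi>\<close> be underivable from \<open>\<Gamma>\<close> and extend \<open>\<Gamma>\<close> to a set \<open>\<Delta>\<close> that is maximal
  among the sets from which \<open>\<phi>\<close> is underivable; Zorn's lemma applies since derivations are
  finite. Every formula outside \<open>\<Delta>\<close> implies \<open>\<phi>\<close> over \<open>\<Delta>\<close>, by the deduction theorem. Hence \<open>\<Delta>\<close>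
  is closed under derivability and prime, i.e. it contains a disjunct of each of its
  disjunctions; the axioms then translate one by one into the clauses saying that membership in
  \<open>\<Delta>\<close> is a bivaluation (\<open>maximal_avoiding_bivaluation\<close>). It satisfies \<open>\<Gamma>\<close> and refutes \<open>\<phi>\<close>.
\<close>


section \<open>Bivaluations and the restricted matrix\<close>

lemma bivaluationD:
  assumes "bivaluation L \<nu>"
  shows "\<nu> (\<alpha> \<^bold>\<or> \<beta>) \<longleftrightarrow> \<nu> \<alpha> \<or> \<nu> \<beta>"
    and "\<nu> (\<alpha> \<^bold>\<and> \<beta>) \<longleftrightarrow> \<nu> \<alpha> \<and> \<nu> \<beta>"
    and "\<nu> (\<alpha> \<^bold>\<longrightarrow> \<beta>) \<longleftrightarrow> \<not> \<nu> \<alpha> \<or> \<nu> \<beta>"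
    and "\<nu> (\<alpha> \<^bold>\<up> \<beta>) \<Longrightarrow> \<not> \<nu> \<alpha> \<or> \<not> \<nu> \<beta>"
    and "\<nu> (\<alpha> \<^bold>\<up> \<beta>) = \<nu> (\<beta> \<^bold>\<up> \<alpha>)"
    and "\<not> \<nu> (\<^bold>\<not> \<alpha>) \<Longrightarrow> \<nu> \<alpha>"
    and "\<not> \<nu> (\<alpha> \<^bold>\<up> \<^bold>\<not> \<alpha>) \<Longrightarrow> \<nu> \<alpha> \<and> \<nu> (\<^bold>\<not> \<alpha>)"
    and "L = nbIci \<Longrightarrow> \<nu> (\<^bold>\<not> (\<alpha> \<^bold>\<up> \<^bold>\<not> \<alpha>)) \<Longrightarrow> \<nu> \<alpha> \<and> \<nu> (\<^bold>\<not> \<alpha>)"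
    and "L = nbIcl \<Longrightarrow> \<nu> (\<^bold>\<not> (\<alpha> \<^bold>\<and> \<^bold>\<not> \<alpha>)) \<Longrightarrow> \<nu> (\<alpha> \<^bold>\<up> \<^bold>\<not> \<alpha>)"
  using assms unfolding bivaluation_def nbI_bivaluation_def by metis+

lemma two_restricted_eq_bivaluations:
  "two_restricted L = {\<nu> :: 'v fm \<Rightarrow> bool. bivaluation L \<nu>}"
proof (intro set_eqI iffI)
  fix \<nu> :: "'v fm \<Rightarrow> bool"
  assume "\<nu> \<in> two_restricted L"
  then show "\<nu> \<in> {\<nu>. bivaluation L \<nu>}"
    by (auto simp: two_restricted_def bivaluation_def nbI_bivaluation_def valuation_def
        two_nbI_def split: if_splits)
next
  fix \<nu> :: "'v fm \<Rightarrow> bool"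
  assume "\<nu> \<in> {\<nu>. bivaluation L \<nu>}"
  then have biv: "bivaluation L \<nu>" ..
  note disj_iff = bivaluationD(1)[OF biv] and conj_iff = bivaluationD(2)[OF biv]
    and imp_iff = bivaluationD(3)[OF biv] and inc = bivaluationD(4)[OF biv]
    and comm = bivaluationD(5)[OF biv] and neg = bivaluationD(6)[OF biv]
    and ciw = bivaluationD(7)[OF biv] and ci = bivaluationD(8)[OF biv]
    and cl = bivaluationD(9)[OF biv]
  have val: "valuation two_nbI \<nu>"
    unfolding valuation_def two_nbI_def
    by (simp add: disj_iff conj_iff imp_iff) (use inc neg in metis)
  have inc_neg_iff: "\<nu> (\<alpha> \<^bold>\<up> \<^bold>\<not> \<alpha>) = (\<not> (\<nu> \<alpha> \<and> \<nu> (\<^bold>\<not> \<alpha>)))" for \<alpha>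
    using inc ciw by blast
  have "\<nu> (\<^bold>\<not> (\<alpha> \<^bold>\<up> \<^bold>\<not> \<alpha>)) = (\<nu> \<alpha> \<and> \<nu> (\<^bold>\<not> \<alpha>))" if "L = nbIci" for \<alpha>
    using ci[OF that] inc_neg_iff neg by blast
  moreover have "\<nu> (\<alpha> \<^bold>\<up> \<^bold>\<not> \<alpha>) = \<nu> (\<^bold>\<not> (\<alpha> \<^bold>\<and> \<^bold>\<not> \<alpha>))" if "L = nbIcl" for \<alpha>
    using cl[OF that] inc_neg_iff neg conj_iff by blast
  ultimately show "\<nu> \<in> two_restricted L"
    unfolding two_restricted_def using val comm inc_neg_iff by blast
qed

corollary bival_conseq_iff_rnmatrix_conseq:
  "bival_conseq L \<Gamma> \<phi> \<longleftrightarrow> rnmatrix_conseq (two_rnmatrix L) \<Gamma> \<phi>"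
  by (auto simp: bival_conseq_def rnmatrix_conseq_def two_rnmatrix_def
      two_restricted_eq_bivaluations)


section \<open>Derivability\<close>

text \<open>
  A derivation is read here as growing at its end, so that induction on lists from the right
  replaces the arithmetic of positions.
\<close>

lemma derivation_snoc:
  "derivation L \<Gamma> (ds @ [\<alpha>]) \<longleftrightarrow>
     derivation L \<Gamma> ds \<and>
     (\<alpha> \<in> nbI_axioms \<union> ext_axioms L \<or> \<alpha> \<in> \<Gamma> \<or> (\<exists>\<beta> \<in> set ds. \<beta> \<^bold>\<longrightarrow> \<alpha> \<in> set ds))"
proof -
  have step: "(\<exists>j < length ds. \<exists>k < length ds. ds ! k = (ds ! j) \<^bold>\<longrightarrow> \<alpha>) \<longleftrightarrow>
      (\<exists>\<beta> \<in> set ds. \<beta> \<^bold>\<longrightarrow> \<alpha> \<in> set ds)"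
    unfolding in_set_conv_nth Bex_def by blast
  have prefix: "(\<exists>j < i. \<exists>k < i. (ds @ [\<alpha>]) ! k = ((ds @ [\<alpha>]) ! j) \<^bold>\<longrightarrow> \<beta>) \<longleftrightarrow>
      (\<exists>j < i. \<exists>k < i. ds ! k = (ds ! j) \<^bold>\<longrightarrow> \<beta>)" if "i \<le> length ds" for i \<beta>
    using that by (simp add: nth_append cong: conj_cong)
  show ?thesis
    unfolding derivation_def length_append_singleton All_less_Suc
    by (simp add: prefix step nth_append cong: conj_cong) (rule conj_commute)
qed

lemma derivation_append:
  "derivation L \<Gamma> (ds @ es)" if "derivation L \<Gamma> ds" "derivation L \<Gamma> es"
  using that(2)
proof (induction es rule: rev_induct)
  case Nil
  then show ?case using that(1) by simp
next
  case (snoc \<alpha> es)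
  then show ?case
    using derivation_snoc[of L \<Gamma> "ds @ es" \<alpha>] by (auto simp: derivation_snoc)
qed

lemma derivable_axiom:
  assumes "\<alpha> \<in> nbI_axioms \<union> ext_axioms L"
  shows "derivable L \<Gamma> \<alpha>"
  unfolding derivable_def
  using assms by (intro exI[of _ "[\<alpha>]"]) (auto simp: derivation_def)

lemmas derivable_nbI_axiom = derivable_axiom[OF UnI1]

lemma derivable_premise:
  assumes "\<alpha> \<in> \<Gamma>"
  shows "derivable L \<Gamma> \<alpha>"
  unfolding derivable_def
  using assms by (intro exI[of _ "[\<alpha>]"]) (auto simp: derivation_def)

lemma derivable_mp:
  assumes "derivable L \<Gamma> (\<alpha> \<^bold>\<longrightarrow> \<beta>)" "derivable L \<Gamma> \<alpha>"
  shows "derivable L \<Gamma> \<beta>"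
proof -
  obtain ds es where "derivation L \<Gamma> ds" "ds \<noteq> []" "last ds = \<alpha> \<^bold>\<longrightarrow> \<beta>"
    and "derivation L \<Gamma> es" "es \<noteq> []" "last es = \<alpha>"
    using assms by (auto simp: derivable_def)
  then have "derivation L \<Gamma> ((ds @ es) @ [\<beta>])"
    unfolding derivation_snoc using derivation_append last_in_set by fastforce
  then show ?thesis
    unfolding derivable_def by (metis last_snoc snoc_eq_iff_butlast)
qed

lemma derivable_induct [consumes 1, case_names axiom premise mp]:
  assumes "derivable L \<Gamma> \<phi>"
    and axiom: "\<And>\<alpha>. \<alpha> \<in> nbI_axioms \<union> ext_axioms L \<Longrightarrow> P \<alpha>"
    and premise: "\<And>\<alpha>. \<alpha> \<in> \<Gamma> \<Longrightarrow> P \<alpha>"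
    and mp: "\<And>\<alpha> \<beta>. P (\<alpha> \<^bold>\<longrightarrow> \<beta>) \<Longrightarrow> P \<alpha> \<Longrightarrow> P \<beta>"
  shows "P \<phi>"
proof -
  have "\<forall>\<alpha> \<in> set ds. P \<alpha>" if "derivation L \<Gamma> ds" for ds
    using that by (induction ds rule: rev_induct) (auto simp: derivation_snoc intro: axiom premise mp)
  then show ?thesis
    using assms(1) last_in_set by (fastforce simp: derivable_def)
qed

lemma derivable_mono:
  assumes "derivable L \<Gamma> \<phi>" "\<Gamma> \<subseteq> \<Delta>"
  shows "derivable L \<Delta> \<phi>"
  using assms(1)
  by (induction rule: derivable_induct)
    (use assms(2) in \<open>auto intro: derivable_axiom derivable_premise derivable_mp\<close>)

text \<open>
  Only finitely many members of the chain contribute premises, and two of them are always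
  comparable; in the induction this shows at modus ponens, where the larger of two members
  derives both premises of the rule.
\<close>

lemma derivable_Union_chain:
  assumes "derivable L (\<Union>\<C>) \<phi>" "\<C> \<noteq> {}" "subset.chain \<A> \<C>"
  shows "\<exists>\<Gamma> \<in> \<C>. derivable L \<Gamma> \<phi>"
  using assms(1)
proof (induction rule: derivable_induct)
  case (axiom \<alpha>)
  then show ?case using assms(2) derivable_axiom by blast
next
  case (premise \<alpha>)
  then show ?case using derivable_premise by blast
next
  case (mp \<alpha> \<beta>)
  then obtain \<Gamma> \<Delta> where "\<Gamma> \<in> \<C>" "derivable L \<Gamma> (\<alpha> \<^bold>\<longrightarrow> \<beta>)" "\<Delta> \<in> \<C>" "derivable L \<Delta> \<alpha>"
    by blast
  moreover from this have "\<Gamma> \<subseteq> \<Delta> \<or> \<Delta> \<subseteq> \<Gamma>"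
    using assms(3) by (auto simp: subset_chain_def)
  ultimately show ?case
    using derivable_mono derivable_mp by metis
qed

lemma deduction_theorem:
  assumes "derivable L (insert \<alpha> \<Gamma>) \<beta>"
  shows "derivable L \<Gamma> (\<alpha> \<^bold>\<longrightarrow> \<beta>)"
proof -
  have weaken: "derivable L \<Gamma> (\<alpha> \<^bold>\<longrightarrow> \<gamma>)" if "derivable L \<Gamma> \<gamma>" for \<gamma>
    using derivable_mp[OF derivable_nbI_axiom[OF Ax1] that] .
  have distrib: "derivable L \<Gamma> (\<alpha> \<^bold>\<longrightarrow> \<delta>)"
    if "derivable L \<Gamma> (\<alpha> \<^bold>\<longrightarrow> (\<gamma> \<^bold>\<longrightarrow> \<delta>))" "derivable L \<Gamma> (\<alpha> \<^bold>\<longrightarrow> \<gamma>)" for \<gamma> \<delta>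
    using derivable_mp[OF derivable_mp[OF derivable_nbI_axiom[OF Ax2] that(1)] that(2)] .
  have refl: "derivable L \<Gamma> (\<alpha> \<^bold>\<longrightarrow> \<alpha>)"
    using distrib derivable_nbI_axiom[OF Ax1] by blast
  from assms show ?thesis
  proof (induction rule: derivable_induct)
    case (axiom \<gamma>)
    then show ?case using weaken derivable_axiom by blast
  next
    case (premise \<gamma>)
    then show ?case using weaken derivable_premise refl by blast
  next
    case (mp \<gamma> \<delta>)
    then show ?case using distrib by blast
  qed
qed


section \<open>Soundness and completeness for bivaluations\<close>

lemma bivaluation_axiom:
  assumes "bivaluation L \<nu>" "\<alpha> \<in> nbI_axioms \<union> ext_axioms L"
  shows "\<nu> \<alpha>"
proof -
  note clauses = bivaluationD[OF assms(1)]
  have "\<nu> \<alpha>" if "\<alpha> \<in> nbI_axioms"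
    using that by induction (metis clauses(1-6))+
  moreover have "\<nu> \<alpha>" if "\<alpha> \<in> ext_axioms L"
  proof (cases L)
    case nbIciw
    then obtain \<beta> where "\<alpha> = (\<beta> \<^bold>\<up> \<^bold>\<not> \<beta>) \<^bold>\<or> (\<beta> \<^bold>\<and> \<^bold>\<not> \<beta>)"
      using \<open>\<alpha> \<in> ext_axioms L\<close> by auto
    then show ?thesis using clauses(1,2,7) by metis
  next
    case nbIci
    then obtain \<beta> where "\<alpha> = \<^bold>\<not> (\<beta> \<^bold>\<up> \<^bold>\<not> \<beta>) \<^bold>\<longrightarrow> (\<beta> \<^bold>\<and> \<^bold>\<not> \<beta>)"
      using \<open>\<alpha> \<in> ext_axioms L\<close> by auto
    then show ?thesis using clauses(2,3) clauses(8)[OF nbIci] by metis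
  next
    case nbIcl
    then obtain \<beta> where "\<alpha> = \<^bold>\<not> (\<beta> \<^bold>\<and> \<^bold>\<not> \<beta>) \<^bold>\<longrightarrow> (\<beta> \<^bold>\<up> \<^bold>\<not> \<beta>)"
      using \<open>\<alpha> \<in> ext_axioms L\<close> by auto
    then show ?thesis using clauses(3) clauses(9)[OF nbIcl] by metis
  qed
  ultimately show ?thesis using assms(2) by blast
qed

lemma soundness:
  assumes "derivable L \<Gamma> \<phi>"
  shows "bival_conseq L \<Gamma> \<phi>"
  unfolding bival_conseq_def
proof (intro allI impI)
  fix \<nu>
  assume biv: "bivaluation L \<nu>" and sat: "\<forall>\<gamma> \<in> \<Gamma>. \<nu> \<gamma>"
  from assms show "\<nu> \<phi>"
  proof (induction rule: derivable_induct)
    case (mp \<alpha> \<beta>)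
    then show ?case
      using bivaluationD(3)[OF biv] by blast
  qed (use biv sat bivaluation_axiom in auto)
qed

text \<open>
  Only \<open>nbIciw\<close> has this formula among its axioms. In the other two calculi it comes from the
  excluded middle for the negated formula in the antecedent of the extra axiom.
\<close>

lemma derivable_ciw:
  "derivable L \<Gamma> ((\<alpha> \<^bold>\<up> \<^bold>\<not> \<alpha>) \<^bold>\<or> (\<alpha> \<^bold>\<and> \<^bold>\<not> \<alpha>))" (is "derivable L \<Gamma> (?inc \<^bold>\<or> ?con)")
proof -
  have by_cases: "derivable L \<Gamma> (?inc \<^bold>\<or> ?con)"
    if "\<beta> \<in> {?inc, ?con}" "derivable L (insert (\<^bold>\<not> \<beta>) \<Gamma>) (?inc \<^bold>\<or> ?con)" for \<beta>
  proof -
    have "derivable L \<Gamma> (\<beta> \<^bold>\<longrightarrow> (?inc \<^bold>\<or> ?con))"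
      using that(1) derivable_nbI_axiom[OF Ax6] derivable_nbI_axiom[OF Ax7] by blast
    moreover have "derivable L \<Gamma> (\<^bold>\<not> \<beta> \<^bold>\<longrightarrow> (?inc \<^bold>\<or> ?con))"
      using that(2) by (rule deduction_theorem)
    moreover have "derivable L \<Gamma> (\<beta> \<^bold>\<or> \<^bold>\<not> \<beta>)"
      by (rule derivable_nbI_axiom[OF Ax11])
    ultimately show ?thesis
      using derivable_nbI_axiom[OF Ax8] derivable_mp by metis
  qed
  show ?thesis
  proof (cases L)
    case nbIciw
    then show ?thesis by (intro derivable_axiom) auto
  next
    case nbIci
    then have "derivable L (insert (\<^bold>\<not> ?inc) \<Gamma>) (\<^bold>\<not> ?inc \<^bold>\<longrightarrow> ?con)"
      by (intro derivable_axiom) auto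
    then have "derivable L (insert (\<^bold>\<not> ?inc) \<Gamma>) ?con"
      using derivable_mp derivable_premise by blast
    then show ?thesis
      using by_cases[of ?inc] derivable_mp[OF derivable_nbI_axiom[OF Ax7]] by blast
  next
    case nbIcl
    then have "derivable L (insert (\<^bold>\<not> ?con) \<Gamma>) (\<^bold>\<not> ?con \<^bold>\<longrightarrow> ?inc)"
      by (intro derivable_axiom) auto
    then have "derivable L (insert (\<^bold>\<not> ?con) \<Gamma>) ?inc"
      using derivable_mp derivable_premise by blast
    then show ?thesis
      using by_cases[of ?con] derivable_mp[OF derivable_nbI_axiom[OF Ax6]] by blast
  qed
qed

text \<open>
  Maximality is stated by one-formula extensions, the form in which the deduction theorem applies
  to it.
\<close>

definition maximal_avoiding :: "nbI_ext \<Rightarrow> 'v fm \<Rightarrow> 'v fm set \<Rightarrow> bool" where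
  "maximal_avoiding L \<phi> \<Delta> \<longleftrightarrow>
     \<not> derivable L \<Delta> \<phi> \<and> (\<forall>\<alpha>. \<alpha> \<notin> \<Delta> \<longrightarrow> derivable L (insert \<alpha> \<Delta>) \<phi>)"

lemma extend_to_maximal_avoiding:
  assumes "\<not> derivable L \<Gamma> \<phi>"
  obtains \<Delta> where "\<Gamma> \<subseteq> \<Delta>" "maximal_avoiding L \<phi> \<Delta>"
proof -
  define \<A> where "\<A> = {\<Delta>. \<Gamma> \<subseteq> \<Delta> \<and> \<not> derivable L \<Delta> \<phi>}"
  have "\<exists>\<Delta> \<in> \<A>. \<forall>X \<in> \<A>. \<Delta> \<subseteq> X \<longrightarrow> X = \<Delta>"
  proof (rule subset_Zorn_nonempty)
    show "\<A> \<noteq> {}"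
      using assms by (auto simp: \<A>_def)
  next
    fix \<C>
    assume "\<C> \<noteq> {}" and chain: "subset.chain \<A> \<C>"
    then have "\<C> \<subseteq> \<A>"
      by (simp add: subset_chain_def)
    then have "\<not> derivable L (\<Union>\<C>) \<phi>"
      using derivable_Union_chain[OF _ \<open>\<C> \<noteq> {}\<close> chain] by (auto simp: \<A>_def)
    moreover have "\<Gamma> \<subseteq> \<Union>\<C>"
      using \<open>\<C> \<noteq> {}\<close> \<open>\<C> \<subseteq> \<A>\<close> by (auto simp: \<A>_def)
    ultimately show "\<Union>\<C> \<in> \<A>"
      by (simp add: \<A>_def)
  qed
  then obtain \<Delta> where "\<Delta> \<in> \<A>" and max: "\<And>X. X \<in> \<A> \<Longrightarrow> \<Delta> \<subseteq> X \<Longrightarrow> X = \<Delta>"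
    by blast
  have "derivable L (insert \<alpha> \<Delta>) \<phi>" if "\<alpha> \<notin> \<Delta>" for \<alpha>
    using max[of "insert \<alpha> \<Delta>"] that \<open>\<Delta> \<in> \<A>\<close> by (auto simp: \<A>_def)
  with \<open>\<Delta> \<in> \<A>\<close> show thesis
    by (intro that[of \<Delta>]) (auto simp: \<A>_def maximal_avoiding_def)
qed

text \<open>
  A derivable formula outside the set would imply the avoided formula over the set, and so make
  the avoided formula derivable.
\<close>

lemma maximal_avoiding_closed:
  assumes "maximal_avoiding L \<phi> \<Delta>"
  shows "derivable L \<Delta> \<alpha> \<longleftrightarrow> \<alpha> \<in> \<Delta>"
  using assms deduction_theorem derivable_mp derivable_premise
  unfolding maximal_avoiding_def by metis

text \<open>
  If neither disjunct belonged to the set, both would imply the avoided formula, and by (8) so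
  would the disjunction.
\<close>

lemma maximal_avoiding_prime:
  assumes max: "maximal_avoiding L \<phi> \<Delta>" and "\<alpha> \<^bold>\<or> \<beta> \<in> \<Delta>"
  shows "\<alpha> \<in> \<Delta> \<or> \<beta> \<in> \<Delta>"
proof (rule ccontr)
  assume "\<not> (\<alpha> \<in> \<Delta> \<or> \<beta> \<in> \<Delta>)"
  then have "derivable L \<Delta> (\<alpha> \<^bold>\<longrightarrow> \<phi>)" "derivable L \<Delta> (\<beta> \<^bold>\<longrightarrow> \<phi>)"
    using max by (auto simp: maximal_avoiding_def intro: deduction_theorem)
  then have "derivable L \<Delta> ((\<alpha> \<^bold>\<or> \<beta>) \<^bold>\<longrightarrow> \<phi>)"
    using derivable_nbI_axiom[OF Ax8] derivable_mp by metis
  then have "derivable L \<Delta> \<phi>"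
    using derivable_mp derivable_premise assms(2) by blast
  then show False
    using max by (simp add: maximal_avoiding_def)
qed

lemma maximal_avoiding_bivaluation:
  assumes max: "maximal_avoiding L \<phi> \<Delta>"
  shows "bivaluation L (\<lambda>\<alpha>. \<alpha> \<in> \<Delta>)"
proof -
  note closed = maximal_avoiding_closed[OF max]
  note prime = maximal_avoiding_prime[OF max]
  have ax: "\<alpha> \<in> \<Delta>" if "\<alpha> \<in> nbI_axioms \<union> ext_axioms L" for \<alpha>
    using derivable_axiom[OF that] closed by blast
  have mp: "\<beta> \<in> \<Delta>" if "\<alpha> \<^bold>\<longrightarrow> \<beta> \<in> \<Delta>" "\<alpha> \<in> \<Delta>" for \<alpha> \<beta>
    using that derivable_mp closed by metis
  have avoid: "\<phi> \<notin> \<Delta>"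
    using max derivable_premise by (auto simp: maximal_avoiding_def)
  have disj: "\<alpha> \<^bold>\<or> \<beta> \<in> \<Delta> \<longleftrightarrow> \<alpha> \<in> \<Delta> \<or> \<beta> \<in> \<Delta>" for \<alpha> \<beta>
    using prime mp ax[OF UnI1[OF Ax6]] ax[OF UnI1[OF Ax7]] by blast
  have conj: "\<alpha> \<^bold>\<and> \<beta> \<in> \<Delta> \<longleftrightarrow> \<alpha> \<in> \<Delta> \<and> \<beta> \<in> \<Delta>" for \<alpha> \<beta>
    using mp ax[OF UnI1[OF Ax3]] ax[OF UnI1[OF Ax4]] ax[OF UnI1[OF Ax5]] by blast
  have imp: "\<alpha> \<^bold>\<longrightarrow> \<beta> \<in> \<Delta> \<longleftrightarrow> \<alpha> \<notin> \<Delta> \<or> \<beta> \<in> \<Delta>" for \<alpha> \<beta>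
    using prime[OF ax[OF UnI1[OF Ax9]]] mp ax[OF UnI1[OF Ax1]] by blast
  \<comment> \<open>The conclusion of (Ip) is arbitrary; taken to be \<open>\<phi>\<close>, it contradicts \<open>\<phi> \<notin> \<Delta>\<close>.\<close>
  have inc: "\<alpha> \<notin> \<Delta> \<or> \<beta> \<notin> \<Delta>" if "\<alpha> \<^bold>\<up> \<beta> \<in> \<Delta>" for \<alpha> \<beta>
    using mp[OF ax[OF UnI1[OF Ip]] that, of \<phi>] mp avoid by blast
  have comm: "\<alpha> \<^bold>\<up> \<beta> \<in> \<Delta> \<longleftrightarrow> \<beta> \<^bold>\<up> \<alpha> \<in> \<Delta>" for \<alpha> \<beta>
    using mp ax[OF UnI1[OF Comm]] by blast
  have neg: "\<alpha> \<in> \<Delta>" if "\<^bold>\<not> \<alpha> \<notin> \<Delta>" for \<alpha>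
    using prime[OF ax[OF UnI1[OF Ax11]]] that by blast
  have ciw: "\<alpha> \<in> \<Delta> \<and> \<^bold>\<not> \<alpha> \<in> \<Delta>" if "\<alpha> \<^bold>\<up> \<^bold>\<not> \<alpha> \<notin> \<Delta>" for \<alpha>
    using derivable_ciw[of L \<Delta> \<alpha>] that by (simp add: closed disj conj)
  have ci: "\<alpha> \<in> \<Delta> \<and> \<^bold>\<not> \<alpha> \<in> \<Delta>" if "L = nbIci" "\<^bold>\<not> (\<alpha> \<^bold>\<up> \<^bold>\<not> \<alpha>) \<in> \<Delta>" for \<alpha>
    using ax[of "\<^bold>\<not> (\<alpha> \<^bold>\<up> \<^bold>\<not> \<alpha>) \<^bold>\<longrightarrow> (\<alpha> \<^bold>\<and> \<^bold>\<not> \<alpha>)"] that by (simp add: imp conj)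
  have cl: "\<alpha> \<^bold>\<up> \<^bold>\<not> \<alpha> \<in> \<Delta>" if "L = nbIcl" "\<^bold>\<not> (\<alpha> \<^bold>\<and> \<^bold>\<not> \<alpha>) \<in> \<Delta>" for \<alpha>
    using ax[of "\<^bold>\<not> (\<alpha> \<^bold>\<and> \<^bold>\<not> \<alpha>) \<^bold>\<longrightarrow> (\<alpha> \<^bold>\<up> \<^bold>\<not> \<alpha>)"] that by (simp add: imp)
  show ?thesis
    unfolding bivaluation_def nbI_bivaluation_def
    using disj conj imp inc comm neg ciw ci cl by blast
qed

lemma completeness:
  assumes "bival_conseq L \<Gamma> \<phi>"
  shows "derivable L \<Gamma> \<phi>"
proof (rule ccontr)
  assume "\<not> derivable L \<Gamma> \<phi>"
  then obtain \<Delta> where "\<Gamma> \<subseteq> \<Delta>" and max: "maximal_avoiding L \<phi> \<Delta>"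
    by (rule extend_to_maximal_avoiding)
  then have "\<phi> \<in> \<Delta>"
    using assms maximal_avoiding_bivaluation[OF max] unfolding bival_conseq_def by blast
  then show False
    using max derivable_premise by (auto simp: maximal_avoiding_def)
qed

theorem corollary4:
  fixes L :: nbI_ext
    and \<Gamma> :: "'v::countable fm set"
    and \<phi> :: "'v fm"
  shows "(bival_conseq L \<Gamma> \<phi> \<longleftrightarrow> rnmatrix_conseq (two_rnmatrix L) \<Gamma> \<phi>) \<and>
         (derivable L \<Gamma> \<phi> \<longleftrightarrow> rnmatrix_conseq (two_rnmatrix L) \<Gamma> \<phi>)"
  using bival_conseq_iff_rnmatrix_conseq soundness completeness by blast

end
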